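(* In the setting described in the context, let $0<\alpha<2$. Let $\mathcal F$ be a cone and suppose there are constants $c_1,c_2>0$ such that for all $\delta>0$, $$H\bigl(\delta,\{f\in\mathcal F: P(f)\le 1\},Q_n\bigr)\le c_1\delta^{-\alpha}$$ and $$H\Bigl(\delta,\Bigl\{\tfrac{f-f^*}{P(f)+P(f^* )}: f\in\mathcal F,\ P(f)+P(f^* )>0\Bigr\},Q_n\Bigr)\le c_2\delta^{-\alpha}.$$ Suppose the errors have sub-Gaussian tails: there are constants $K,\sigma_0>0$ with $$\sup_n\max_{i=1,\dots,n}K^2\bigl(\mathbb E\,e^{|w_i|^2/K^2}-1\bigr)\le\sigma_0^2.$$ Let $P(f^* )>0$ and let $\lambda_n=O_p\bigl(n^{-2/(2+\alpha)}\bigr)$. If $$L\bigl(\Omega(\tilde f_D)\bigr)\le L(\hat f)+\Gamma_{n,m},$$ then $$\bigl\|\Omega(\tilde f_D)-f^*\bigr\|_n^2=O_p\bigl(\lambda_n+6\,\Gamma_{n,m}\bigr).$$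
   Context: Data and model. We have covariates $x_i\in[a,b]$ and observations $y_i=f^*(x_i)+w_i$, $i=1,\dots,n$, where the $w_i$ are iid errors with mean $0$ and finite variance, and $f^*\in\mathcal F$ is an unknown function in a known class $\mathcal F$ of real functions on $[a,b]$. A cone is a class closed under multiplication by positive scalars. Norm and entropy. $Q_n$ is the empirical measure of $x_1,\dots,x_n$ and $\|g\|_n^2=\frac1n\sum_{i=1}^n g(x_i)^2$. For a class $\mathcal G$ of functions, $H(\delta,\mathcal G,Q_n)=\log N(\delta,\mathcal G,Q_n)$, where $N(\delta,\mathcal G,Q_n)$ is the $\delta$-covering number of $\mathcal G$ in the $L_2(Q_n)$-metric, i.e. the (pseudo)metric induced by $\|\cdot\|_n$. Penalty. Fix an integer $r\ge 0$ and $\ell>0$. For $f\in\mathcal F$, $P(f)=\int_a^b |f^{(r+1)}(t)|^\ell\,dt$ (a Sobolev penalty), understood to be defined and finite on $\mathcal F$. Mesh and discretized penalty. $D$ is a mesh $a=d_1<d_2<\dots<d_m=b$. For $v\in\mathbb R^m$ put $v^{(0)}=v$ and, for $s=0,\dots,r$ and $i=1,\dots,m-s-1$, $h^{(s)}_i=\frac{d_{i+s+1}-d_i}{s+1}$ and $v^{(s+1)}_i=\bigl(v^{(s)}_{i+1}-v^{(s)}_i\bigr)/h^{(s)}_i$. Then $P_D(v)=\sum_{i=1}^{m-r-1}h^{(r)}_i\,|v^{(r+1)}_i|^\ell$, a finite-difference/Riemann-sum approximation of $P$. Interpolator. $\Omega:\mathbb R^m\to\mathcal F$ is a linear interpolation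 map: $\Omega(v)\in\mathcal F$ is a function on $[a,b]$, linear in $v$, whose value at $d_j$ is $v_j$ for each $j$. Write $\Omega_x(v)$ for the value of $\Omega(v)$ at $x$. Objectives and estimators. With tuning parameter $\lambda_n\ge 0$, $$L(f)=\frac1n\sum_{i=1}^n (y_i-f(x_i))^2+\lambda_nP(f),\qquad \hat f\in\operatorname{argmin}_{f\in\mathcal F}L(f),$$ $$L_D(v)=\frac1n\sum_{i=1}^n (y_i-\Omega_{x_i}(v))^2+\lambda_nP_D(v),\qquad \tilde f_D\in\operatorname{argmin}_{v\in\mathbb R^m}L_D(v),$$ where the minimizers are taken to exist. $\Gamma_{n,m}$ is a quantity depending on $n$ and $m$ (nonnegative whenever the displayed inequality for $L$ holds, since $L(\hat f)\le L(\Omega(\tilde f_D))$). Asymptotics. $n\to\infty$. $Z_n=O_p(A_n)$ means that for every $\eta>0$ there is $M$ with $\limsup_n\Pr(|Z_n|>MA_n)\le\eta$.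
   Formalization: Besides λ_n = O_p(n^{-2/(2+α)}), the theorem also assumes the matching lower bound n^{-2/(2+α)} = O_p(λ_n); without a lower bound the claim is false, e.g. λ_n = 0 and Γ = 0 with a positive error. *)

theory Defs
  imports "HOL-Probability.Probability"
begin

(* Functions on [a,b] are rendered as functions real => real of which only the values on {a..b}
   matter.  Sample and mesh indices start at 1. *)

definition empirical_norm :: "nat \<Rightarrow> (nat \<Rightarrow> real) \<Rightarrow> (real \<Rightarrow> real) \<Rightarrow> real" where
  "empirical_norm n x g = sqrt ((\<Sum>i=1..n. (g (x i))\<^sup>2) / real n)"

(* The centres of the closed balls need not lie in the covered class.
   The infimum of the empty set of covers is \<infinity>. *)
definition covering_number ::
    "nat \<Rightarrow> (nat \<Rightarrow> real) \<Rightarrow> real \<Rightarrow> (real \<Rightarrow> real) set \<Rightarrow> enat" where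
  "covering_number n x \<delta> G =
     (INF C \<in> {C. finite C \<and> (\<forall>g\<in>G. \<exists>c\<in>C. empirical_norm n x (\<lambda>t. g t - c t) \<le> \<delta>)}.
        enat (card C))"

definition entropy :: "nat \<Rightarrow> (nat \<Rightarrow> real) \<Rightarrow> real \<Rightarrow> (real \<Rightarrow> real) set \<Rightarrow> ereal" where
  "entropy n x \<delta> G =
     (case covering_number n x \<delta> G of enat N \<Rightarrow> ereal (ln (real N)) | \<infinity> \<Rightarrow> \<infinity>)"

definition function_cone :: "(real \<Rightarrow> real) set \<Rightarrow> bool" where
  "function_cone F \<longleftrightarrow> (\<forall>f\<in>F. \<forall>c>0. (\<lambda>t. c * f t) \<in> F)"

(* The iterated deriv is the a.e. derivative f^(r+1) on functions that satisfy sobolev_finite below.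
   The open interval is used because deriv at a and at b would depend on values outside [a,b]. *)
definition sobolev_penalty :: "nat \<Rightarrow> real \<Rightarrow> real \<Rightarrow> real \<Rightarrow> (real \<Rightarrow> real) \<Rightarrow> real" where
  "sobolev_penalty r l a b f = (LBINT t:{a<..<b}. \<bar>(deriv ^^ Suc r) f t\<bar> powr l)"

(* The penalty of f is defined and finite: f^(0), ..., f^(r-1) are differentiable, f^(r) is locally
   absolutely continuous on the open interval, being the integral of its a.e. derivative f^(r+1),
   and |f^(r+1)|^l is integrable. *)
definition sobolev_finite :: "nat \<Rightarrow> real \<Rightarrow> real \<Rightarrow> real \<Rightarrow> (real \<Rightarrow> real) \<Rightarrow> bool" where
  "sobolev_finite r l a b f \<longleftrightarrow>
     (\<forall>s<r. \<forall>t\<in>{a<..<b}. (deriv ^^ s) f differentiable at t) \<and>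
     (\<forall>s t. a < s \<and> s \<le> t \<and> t < b \<longrightarrow>
        set_integrable lborel {s..t} ((deriv ^^ Suc r) f) \<and>
        (deriv ^^ r) f t - (deriv ^^ r) f s = (LBINT u:{s..t}. (deriv ^^ Suc r) f u)) \<and>
     set_integrable lborel {a<..<b} (\<lambda>t. \<bar>(deriv ^^ Suc r) f t\<bar> powr l)"

definition is_mesh :: "real \<Rightarrow> real \<Rightarrow> nat \<Rightarrow> (nat \<Rightarrow> real) \<Rightarrow> bool" where
  "is_mesh a b m d \<longleftrightarrow> 2 \<le> m \<and> d 1 = a \<and> d m = b \<and> strict_mono_on {1..m} d"

definition mesh_step :: "(nat \<Rightarrow> real) \<Rightarrow> nat \<Rightarrow> nat \<Rightarrow> real" where
  "mesh_step d s i = (d (i + s + 1) - d i) / real (s + 1)"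

fun mesh_diff :: "(nat \<Rightarrow> real) \<Rightarrow> nat \<Rightarrow> (nat \<Rightarrow> real) \<Rightarrow> nat \<Rightarrow> real" where
  "mesh_diff d 0 v i = v i"
| "mesh_diff d (Suc s) v i = (mesh_diff d s v (i + 1) - mesh_diff d s v i) / mesh_step d s i"

(* The sum is empty if m <= r + 1. *)
definition mesh_penalty ::
    "nat \<Rightarrow> real \<Rightarrow> nat \<Rightarrow> (nat \<Rightarrow> real) \<Rightarrow> (nat \<Rightarrow> real) \<Rightarrow> real" where
  "mesh_penalty r l m d v =
     (\<Sum>i=1..m - r - 1. mesh_step d r i * \<bar>mesh_diff d (r + 1) v i\<bar> powr l)"

(* R^m, as the functions supported on {1..m}. *)
definition Rvec :: "nat \<Rightarrow> (nat \<Rightarrow> real) set" where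
  "Rvec m = {v. \<forall>j. j \<notin> {1..m} \<longrightarrow> v j = 0}"

definition linear_interpolator ::
    "real \<Rightarrow> real \<Rightarrow> (real \<Rightarrow> real) set \<Rightarrow> nat \<Rightarrow> (nat \<Rightarrow> real) \<Rightarrow>
     ((nat \<Rightarrow> real) \<Rightarrow> real \<Rightarrow> real) \<Rightarrow> bool" where
  "linear_interpolator a b F m d \<Omega> \<longleftrightarrow>
     (\<forall>v\<in>Rvec m. \<Omega> v \<in> F) \<and>
     (\<forall>u\<in>Rvec m. \<forall>v\<in>Rvec m. \<forall>p q. \<forall>t\<in>{a..b}.
        \<Omega> (\<lambda>j. p * u j + q * v j) t = p * \<Omega> u t + q * \<Omega> v t) \<and>
     (\<forall>v\<in>Rvec m. \<forall>j\<in>{1..m}. \<Omega> v (d j) = v j)"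

definition objective ::
    "((real \<Rightarrow> real) \<Rightarrow> real) \<Rightarrow> nat \<Rightarrow> (nat \<Rightarrow> real) \<Rightarrow> (nat \<Rightarrow> real) \<Rightarrow> real \<Rightarrow>
     (real \<Rightarrow> real) \<Rightarrow> real" where
  "objective P n x y lam f = (\<Sum>i=1..n. (y i - f (x i))\<^sup>2) / real n + lam * P f"

definition mesh_objective ::
    "((nat \<Rightarrow> real) \<Rightarrow> real) \<Rightarrow> ((nat \<Rightarrow> real) \<Rightarrow> real \<Rightarrow> real) \<Rightarrow>
     nat \<Rightarrow> (nat \<Rightarrow> real) \<Rightarrow> (nat \<Rightarrow> real) \<Rightarrow> real \<Rightarrow> (nat \<Rightarrow> real) \<Rightarrow> real" where
  "mesh_objective PD \<Omega> n x y lam v =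
     (\<Sum>i=1..n. (y i - \<Omega> v (x i))\<^sup>2) / real n + lam * PD v"

(* Z_n = O_p(A_n).  Outer measure agrees with the probability on events; using it, nothing has to be
   assumed about measurability of minimizers.  A lower bound 1/lambda_n = O_p(1/A_n) is written
   bounded_in_prob M A lambda, because inverse 0 = 0 would let lambda_n = 0 satisfy it.
   An upper bound on lambda_n alone does not suffice for the rate: with lambda_n = 0 the minimizers
   may fit the noise, and the error need not be O_p(0). *)
definition bounded_in_prob ::
    "'a measure \<Rightarrow> (nat \<Rightarrow> 'a \<Rightarrow> real) \<Rightarrow> (nat \<Rightarrow> 'a \<Rightarrow> real) \<Rightarrow> bool" where
  "bounded_in_prob M Z A \<longleftrightarrow>
     (\<forall>\<eta>>0. \<exists>C::real.
        limsup (\<lambda>n. outer_measure_of M {\<omega> \<in> space M. \<bar>Z n \<omega>\<bar> > C * A n \<omega>}) \<le> ennreal \<eta>)"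

end

theory Submission
  imports Defs
begin

text \<open>Rescaling by \<open>P f + P f\<^sup>*\<close> puts the error \<open>f - f\<^sup>*\<close> into a class with polynomial entropy, and
  chaining over its covers with sub-Gaussian tails gives, with probability close to 1, the modulus
  \<open>\<bar>(w, f - f\<^sup>*)\<^sub>n\<bar> \<le> T n\<^bsup>-1/2\<^esup> \<parallel>f - f\<^sup>*\<parallel>\<^bsup>1-\<alpha>/2\<^esup> (P f + P f\<^sup>*)\<^bsup>\<alpha>/2\<^esup>\<close> for all \<open>f\<close> at once.  A near-minimizer \<open>f\<close>
  satisfies \<open>\<parallel>f - f\<^sup>*\<parallel>\<^sup>2 + \<lambda> P f \<le> 2 (w, f - f\<^sup>*)\<^sub>n + \<lambda> P f\<^sup>* + \<Gamma>\<close>, and Young's inequality absorbs the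
  modulus into the left-hand side as soon as \<open>n\<^bsup>-2/(2+\<alpha>)\<^esup>\<close> is of order at most \<open>\<lambda>\<close>.\<close>

subsection \<open>Covers and the empirical norm\<close>

text \<open>An infimum of a nonempty family in \<open>enat\<close> is attained, so a finite entropy
  bound yields an actual cover. Finiteness also rules out the empty family, whose infimum is
  infinite.\<close>

lemma finite_cover_of_entropy_le:
  assumes "entropy n x \<delta> G \<le> ereal e"
  obtains C where "finite C" "real (card C) \<le> exp e"
    "\<And>g. g \<in> G \<Longrightarrow> \<exists>c\<in>C. empirical_norm n x (\<lambda>t. g t - c t) \<le> \<delta>"
proof -
  define \<S> where
    "\<S> = {C. finite C \<and> (\<forall>g\<in>G. \<exists>c\<in>C. empirical_norm n x (\<lambda>t. g t - c t) \<le> \<delta>)}"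
  have cn: "covering_number n x \<delta> G = Inf ((\<lambda>C. enat (card C)) ` \<S>)"
    by (simp add: covering_number_def \<S>_def)
  obtain N where N: "covering_number n x \<delta> G = enat N"
    using assms by (cases "covering_number n x \<delta> G") (auto simp: entropy_def)
  then have "\<S> \<noteq> {}"
    unfolding cn by (auto simp: Inf_enat_def)
  then have "enat N \<in> (\<lambda>C. enat (card C)) ` \<S>"
    unfolding N[symmetric] cn Inf_enat_def by (auto intro: LeastI_ex)
  then obtain C where C: "C \<in> \<S>" "card C = N"
    by auto
  have "ln (real N) \<le> e"
    using assms by (simp add: entropy_def N)
  \<comment> \<open>For \<open>N = 0\<close> the logarithm carries no information, but the bound is
    then trivial.\<close>
  then have "real N \<le> exp e"
    by (cases "N = 0") (auto simp flip: ln_le_cancel_iff)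
  with C show thesis
    by (intro that[of C]) (auto simp: \<S>_def)
qed

text \<open>Gives access to the triangle and Cauchy-Schwarz inequalities of
  \<open>L2_set\<close>.\<close>

lemma empirical_norm_L2_set:
  "empirical_norm n x g = L2_set (\<lambda>i. g (x i)) {1..n} / sqrt (real n)"
  by (simp add: empirical_norm_def L2_set_def real_sqrt_divide)

lemma empirical_norm_nonneg: "0 \<le> empirical_norm n x g"
  by (simp add: empirical_norm_L2_set)

lemma empirical_norm_power2: "(empirical_norm n x g)\<^sup>2 = (\<Sum>i=1..n. (g (x i))\<^sup>2) / real n"
  by (simp add: empirical_norm_def sum_nonneg)

lemma empirical_norm_scale: "empirical_norm n x (\<lambda>t. c * g t) = \<bar>c\<bar> * empirical_norm n x g"
  by (simp add: empirical_norm_def power_mult_distrib real_sqrt_mult flip: sum_distrib_left times_divide_eq_right)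

lemma empirical_norm_add_le:
  "empirical_norm n x (\<lambda>t. f t + g t) \<le> empirical_norm n x f + empirical_norm n x g"
  using L2_set_triangle_ineq[of "\<lambda>i. f (x i)" "\<lambda>i. g (x i)" "{1..n}"]
  by (simp add: empirical_norm_L2_set add_divide_distrib[symmetric] divide_right_mono)

lemma empirical_norm_minus_commute:
  "empirical_norm n x (\<lambda>t. f t - g t) = empirical_norm n x (\<lambda>t. g t - f t)"
  by (simp add: empirical_norm_def power2_commute)

lemma empirical_norm_diff_le:
  "empirical_norm n x (\<lambda>t. f t - g t)
    \<le> empirical_norm n x (\<lambda>t. h t - f t) + empirical_norm n x (\<lambda>t. h t - g t)"
  using empirical_norm_add_le[of n x "\<lambda>t. f t - h t" "\<lambda>t. h t - g t"]
  by (simp add: empirical_norm_minus_commute[of n x f h])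

text \<open>The first argument is a vector indexed by observations because the noise is not a
  function of the covariate: equal design points may carry different errors.\<close>

definition empirical_inner :: "nat \<Rightarrow> (nat \<Rightarrow> real) \<Rightarrow> (nat \<Rightarrow> real) \<Rightarrow> (real \<Rightarrow> real) \<Rightarrow> real" where
  "empirical_inner n x v g = (\<Sum>i=1..n. v i * g (x i)) / real n"

lemma empirical_inner_scale: "empirical_inner n x v (\<lambda>t. c * g t) = c * empirical_inner n x v g"
  by (simp add: empirical_inner_def sum_distrib_left mult_ac)

lemma empirical_inner_diff:
  "empirical_inner n x v (\<lambda>t. f t - g t) = empirical_inner n x v f - empirical_inner n x v g"
  by (simp add: empirical_inner_def sum_subtractf algebra_simps diff_divide_distrib)

text \<open>Cauchy-Schwarz. The factor in \<open>v\<close> may be large; chaining only needs that it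
  does not depend on \<open>g\<close>, so that the remainder of a chain tends to 0.\<close>

lemma empirical_inner_le:
  "\<bar>empirical_inner n x v g\<bar> \<le> L2_set v {1..n} / sqrt (real n) * empirical_norm n x g"
proof -
  have "\<bar>\<Sum>i=1..n. v i * g (x i)\<bar> \<le> (\<Sum>i=1..n. \<bar>v i\<bar> * \<bar>g (x i)\<bar>)"
    using sum_abs[of "\<lambda>i. v i * g (x i)" "{1..n}"] by (simp add: abs_mult)
  also have "\<dots> \<le> L2_set v {1..n} * L2_set (\<lambda>i. g (x i)) {1..n}"
    by (rule L2_set_mult_ineq)
  finally show ?thesis
    by (simp add: empirical_inner_def empirical_norm_L2_set divide_right_mono)
qed

text \<open>Expanding the square around the truth \<open>f\<close> isolates the sum of squared
  errors, which is the same for every \<open>g\<close> and cancels when two objective values are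
  compared.\<close>

lemma objective_add_noise:
  "objective P n x (\<lambda>i. f (x i) + v i) lam g =
    (\<Sum>i=1..n. (v i)\<^sup>2) / real n - 2 * empirical_inner n x v (\<lambda>t. g t - f t)
      + (empirical_norm n x (\<lambda>t. g t - f t))\<^sup>2 + lam * P g"
proof -
  have "(f (x i) + v i - g (x i))\<^sup>2
      = (v i)\<^sup>2 - 2 * (v i * (g (x i) - f (x i))) + (g (x i) - f (x i))\<^sup>2" for i
    by (simp add: power2_eq_square algebra_simps)
  then show ?thesis
    by (simp add: objective_def empirical_inner_def empirical_norm_power2 sum.distrib sum_subtractf
        add_divide_distrib diff_divide_distrib flip: sum_distrib_left)
qed

subsection \<open>Sub-Gaussian sums\<close>

text \<open>The linear term is kept apart because it vanishes in expectation for a centred variable,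
  leaving a bound of second order.\<close>

lemma exp_le_add_exp_power2: "exp x \<le> x + exp (x\<^sup>2)" for x :: real
proof -
  have sq: "1 + x\<^sup>2 \<le> exp (x\<^sup>2)"
    by (rule exp_ge_add_one_self)
  consider "x \<ge> 1" | "0 \<le> x" "x \<le> 1" | "x \<le> 0"
    by linarith
  then show ?thesis
  proof cases
    case 1
    then have "x \<le> x\<^sup>2"
      by (simp add: power2_eq_square)
    then have "exp x \<le> exp (x\<^sup>2)"
      by simp
    with 1 show ?thesis by linarith
  next
    case 2
    with exp_bound[of x] sq show ?thesis by linarith
  next
    case 3
    \<comment> \<open>For negative \<open>x\<close>, the upper bound
      \<open>1 + x + x\<^sup>2\<close> on \<open>exp x\<close> comes from inverting the Taylor lower
      bound at \<open>- x\<close>.\<close>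
    have "(1 + (- x) + (- x)\<^sup>2 / 2) \<le> exp (- x)"
      by (rule exp_lower_Taylor_quadratic) (use 3 in simp)
    have q: "0 \<le> 1 + x + x\<^sup>2"
      using zero_le_power2[of "x + 1/2"] by (simp add: power2_eq_square algebra_simps)
    have "1 \<le> (1 + x + x\<^sup>2) * (1 + (- x) + (- x)\<^sup>2 / 2)"
    proof -
      have "(1 + x + x\<^sup>2) * (1 + (- x) + (- x)\<^sup>2 / 2) = 1 + x\<^sup>2 * (1 - x + x\<^sup>2) / 2"
        by (simp add: power2_eq_square field_simps)
      moreover have "0 \<le> x\<^sup>2 * (1 - x + x\<^sup>2)"
        using 3 by (intro mult_nonneg_nonneg add_nonneg_nonneg) auto
      ultimately show ?thesis by linarith
    qed
    also have "\<dots> \<le> (1 + x + x\<^sup>2) * exp (- x)"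
      by (intro mult_left_mono q) fact
    finally have "exp x \<le> 1 + x + x\<^sup>2"
      by (simp add: exp_minus field_simps)
    with sq show ?thesis by linarith
  qed
qed

text \<open>The chord of \<open>exp\<close> from 0 to \<open>z\<close> lies above the graph. The
  bound is linear in \<open>exp z\<close>, so a moment condition on \<open>exp z\<close> carries
  over to smaller exponents.\<close>

lemma exp_mult_le_convex:
  fixes \<theta> z :: real
  assumes "0 \<le> \<theta>" "\<theta> \<le> 1"
  shows "exp (\<theta> * z) \<le> 1 + \<theta> * (exp z - 1)"
proof -
  have "convex_on UNIV (exp :: real \<Rightarrow> real)"
    using convex_on_exp[of 1] by simp
  from convex_onD[OF this, of \<theta> 0 z] assms show ?thesis
    by (simp add: algebra_simps)
qed

text \<open>For small \<open>s\<close> the mean-zero linear term disappears and the chord bound with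
  weight \<open>s\<^sup>2 * K\<^sup>2\<close> leaves \<open>\<sigma>\<^sup>2\<close>. For large
  \<open>s\<close> the inequality \<open>amgm\<close> suffices: the moment condition costs a factor
  \<open>exp (\<sigma>\<^sup>2 / K\<^sup>2)\<close>, which is absorbed because
  \<open>s\<^sup>2 * K\<^sup>2\<close> exceeds 1.\<close>

lemma (in prob_space) sub_gaussian_mgf:
  fixes X :: "'a \<Rightarrow> real"
  assumes X: "integrable M X" "expectation X = 0"
    and K: "0 < K"
    and int: "integrable M (\<lambda>\<omega>. exp ((X \<omega>)\<^sup>2 / K\<^sup>2))"
    and le: "K\<^sup>2 * (expectation (\<lambda>\<omega>. exp ((X \<omega>)\<^sup>2 / K\<^sup>2)) - 1) \<le> \<sigma>\<^sup>2"
  shows "integrable M (\<lambda>\<omega>. exp (s * X \<omega>))"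
    and "expectation (\<lambda>\<omega>. exp (s * X \<omega>)) \<le> exp (s\<^sup>2 * (K\<^sup>2 + \<sigma>\<^sup>2))"
proof -
  note [measurable] = borel_measurable_integrable[OF X(1)]
  let ?E = "expectation (\<lambda>\<omega>. exp ((X \<omega>)\<^sup>2 / K\<^sup>2))"
  have le': "?E \<le> 1 + \<sigma>\<^sup>2 / K\<^sup>2"
    using le K by (simp add: field_simps)
  have amgm: "s * z \<le> s\<^sup>2 * K\<^sup>2 + z\<^sup>2 / K\<^sup>2" for z :: real
  proof -
    have "2 * ((s * K) * (z / K)) \<le> (s * K)\<^sup>2 + (z / K)\<^sup>2"
      using sum_squares_bound[of "s * K" "z / K"] by (simp only: mult.assoc)
    moreover have "(s * K) * (z / K) = s * z"
      using K by simp
    moreover have "0 \<le> (s * K)\<^sup>2 + (z / K)\<^sup>2"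
      by simp
    ultimately have "s * z \<le> (s * K)\<^sup>2 + (z / K)\<^sup>2"
      by linarith
    then show ?thesis
      by (simp add: power_mult_distrib power_divide)
  qed
  have int': "integrable M (\<lambda>\<omega>. exp (s\<^sup>2 * K\<^sup>2) * exp ((X \<omega>)\<^sup>2 / K\<^sup>2))"
    using int by simp
  show intg: "integrable M (\<lambda>\<omega>. exp (s * X \<omega>))"
    by (rule Bochner_Integration.integrable_bound[OF int'])
      (auto simp: amgm simp flip: exp_add)
  show "expectation (\<lambda>\<omega>. exp (s * X \<omega>)) \<le> exp (s\<^sup>2 * (K\<^sup>2 + \<sigma>\<^sup>2))"
  proof (cases "s\<^sup>2 * K\<^sup>2 \<le> 1")
    case True
    have pw: "exp (s * X \<omega>) \<le> s * X \<omega> + (1 + s\<^sup>2 * K\<^sup>2 * (exp ((X \<omega>)\<^sup>2 / K\<^sup>2) - 1))" for \<omega>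
    proof -
      have "exp ((s * X \<omega>)\<^sup>2) = exp (s\<^sup>2 * K\<^sup>2 * ((X \<omega>)\<^sup>2 / K\<^sup>2))"
        using K by (simp add: power_mult_distrib)
      also have "\<dots> \<le> 1 + s\<^sup>2 * K\<^sup>2 * (exp ((X \<omega>)\<^sup>2 / K\<^sup>2) - 1)"
        using True by (intro exp_mult_le_convex) auto
      finally show ?thesis
        using exp_le_add_exp_power2[of "s * X \<omega>"] by linarith
    qed
    have "expectation (\<lambda>\<omega>. exp (s * X \<omega>))
        \<le> expectation (\<lambda>\<omega>. s * X \<omega> + (1 + s\<^sup>2 * K\<^sup>2 * (exp ((X \<omega>)\<^sup>2 / K\<^sup>2) - 1)))"
      by (intro integral_mono intg pw) (use X int in auto)
    also have "\<dots> = 1 + s\<^sup>2 * (K\<^sup>2 * (?E - 1))"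
      using X int by (simp add: prob_space)
    also have "\<dots> \<le> 1 + s\<^sup>2 * \<sigma>\<^sup>2"
      by (intro add_left_mono mult_left_mono le) auto
    also have "\<dots> \<le> exp (s\<^sup>2 * \<sigma>\<^sup>2)"
      by (rule exp_ge_add_one_self)
    also have "\<dots> \<le> exp (s\<^sup>2 * (K\<^sup>2 + \<sigma>\<^sup>2))"
      by (simp add: distrib_left)
    finally show ?thesis .
  next
    case False
    have "expectation (\<lambda>\<omega>. exp (s * X \<omega>)) \<le> expectation (\<lambda>\<omega>. exp (s\<^sup>2 * K\<^sup>2) * exp ((X \<omega>)\<^sup>2 / K\<^sup>2))"
      by (intro integral_mono intg int') (simp add: amgm flip: exp_add)
    also have "\<dots> = exp (s\<^sup>2 * K\<^sup>2) * ?E"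
      by simp
    also have "\<dots> \<le> exp (s\<^sup>2 * K\<^sup>2) * exp (\<sigma>\<^sup>2 / K\<^sup>2)"
      using le' exp_ge_add_one_self[of "\<sigma>\<^sup>2 / K\<^sup>2"] by (intro mult_left_mono) (linarith | simp)+
    also have "\<dots> \<le> exp (s\<^sup>2 * (K\<^sup>2 + \<sigma>\<^sup>2))"
    proof -
      have "\<sigma>\<^sup>2 / K\<^sup>2 * 1 \<le> \<sigma>\<^sup>2 / K\<^sup>2 * (s\<^sup>2 * K\<^sup>2)"
        using False by (intro mult_left_mono) auto
      then show ?thesis
        using K by (simp add: distrib_left mult_ac flip: exp_add)
    qed
    finally show ?thesis .
  qed
qed

text \<open>Chernoff's method. A positive bound \<open>V\<close> replaces the sum of squared weights
  so that vanishing weights cause no division by 0.\<close>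

lemma (in prob_space) sub_gaussian_sum_upper_tail:
  fixes X :: "'i \<Rightarrow> 'a \<Rightarrow> real"
  assumes fin: "finite I" and indep: "indep_vars (\<lambda>_. borel) X I"
    and int: "\<And>i s. i \<in> I \<Longrightarrow> integrable M (\<lambda>\<omega>. exp (s * X i \<omega>))"
    and mgf: "\<And>i s. i \<in> I \<Longrightarrow> expectation (\<lambda>\<omega>. exp (s * X i \<omega>)) \<le> exp (s\<^sup>2 * A)"
    and A: "0 < A" and V: "0 < V" "(\<Sum>i\<in>I. (u i)\<^sup>2) \<le> V" and \<tau>: "0 < \<tau>"
  shows "prob {\<omega>\<in>space M. \<tau> \<le> (\<Sum>i\<in>I. X i \<omega> * u i)} \<le> exp (- \<tau>\<^sup>2 / (4 * A * V))"
proof -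
  \<comment> \<open>This \<open>s\<close> minimizes the exponent
    \<open>- s * \<tau> + s\<^sup>2 * A * V\<close>.\<close>
  define s where "s = \<tau> / (2 * A * V)"
  have s: "0 < s"
    using A V \<tau> by (simp add: s_def)
  let ?S = "\<lambda>\<omega>. \<Sum>i\<in>I. X i \<omega> * u i"
  have eq: "exp (s * ?S \<omega>) = (\<Prod>i\<in>I. exp ((s * u i) * X i \<omega>))" for \<omega>
    by (simp add: sum_distrib_left exp_sum fin mult_ac)
  have ind: "indep_vars (\<lambda>_. borel) (\<lambda>i \<omega>. exp ((s * u i) * X i \<omega>)) I"
    by (rule indep_vars_compose2[OF indep]) auto
  have ints: "integrable M (\<lambda>\<omega>. exp (s * ?S \<omega>))"
    unfolding eq by (rule indep_vars_integrable[OF fin ind int])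
  have "expectation (\<lambda>\<omega>. exp (s * ?S \<omega>)) = (\<Prod>i\<in>I. expectation (\<lambda>\<omega>. exp ((s * u i) * X i \<omega>)))"
    unfolding eq by (rule indep_vars_lebesgue_integral[OF fin ind int])
  also have "\<dots> \<le> (\<Prod>i\<in>I. exp ((s * u i)\<^sup>2 * A))"
    by (intro prod_mono conjI mgf integral_nonneg) auto
  also have "\<dots> = exp (s\<^sup>2 * A * (\<Sum>i\<in>I. (u i)\<^sup>2))"
    by (simp add: exp_sum[OF fin, symmetric] sum_distrib_left power_mult_distrib mult_ac)
  also have "\<dots> \<le> exp (s\<^sup>2 * A * V)"
    using A V by (simp add: mult_left_mono)
  finally have E: "expectation (\<lambda>\<omega>. exp (s * ?S \<omega>)) \<le> exp (s\<^sup>2 * A * V)" .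
  have "prob {\<omega>\<in>space M. \<tau> \<le> ?S \<omega>} \<le> exp (- s * \<tau>) * (\<integral>\<omega>\<in>space M. exp (s * ?S \<omega>) \<partial>M)"
    using integrable_mult_indicator[OF sets.top ints]
    by (intro Chernoff_ineq_ge s) (auto simp: set_integrable_def)
  also have "(\<integral>\<omega>\<in>space M. exp (s * ?S \<omega>) \<partial>M) = expectation (\<lambda>\<omega>. exp (s * ?S \<omega>))"
    by (rule set_integral_space[OF ints])
  also have "exp (- s * \<tau>) * \<dots> \<le> exp (- s * \<tau>) * exp (s\<^sup>2 * A * V)"
    by (intro mult_left_mono E) auto
  also have "\<dots> = exp (- \<tau>\<^sup>2 / (4 * A * V))"
    using A V by (simp add: s_def power2_eq_square field_simps flip: exp_add)
  finally show ?thesis .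
qed

lemma (in prob_space) sub_gaussian_sum_tail:
  fixes X :: "'i \<Rightarrow> 'a \<Rightarrow> real"
  assumes fin: "finite I" and indep: "indep_vars (\<lambda>_. borel) X I"
    and int: "\<And>i s. i \<in> I \<Longrightarrow> integrable M (\<lambda>\<omega>. exp (s * X i \<omega>))"
    and mgf: "\<And>i s. i \<in> I \<Longrightarrow> expectation (\<lambda>\<omega>. exp (s * X i \<omega>)) \<le> exp (s\<^sup>2 * A)"
    and A: "0 < A" and V: "0 < V" "(\<Sum>i\<in>I. (u i)\<^sup>2) \<le> V" and \<tau>: "0 < \<tau>"
  shows "prob {\<omega>\<in>space M. \<tau> \<le> \<bar>\<Sum>i\<in>I. X i \<omega> * u i\<bar>} \<le> 2 * exp (- \<tau>\<^sup>2 / (4 * A * V))"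
proof -
  have [measurable]: "i \<in> I \<Longrightarrow> X i \<in> borel_measurable M" for i
    using indep by (auto simp: indep_vars_def)
  have "prob {\<omega>\<in>space M. \<tau> \<le> \<bar>\<Sum>i\<in>I. X i \<omega> * u i\<bar>}
      \<le> prob ({\<omega>\<in>space M. \<tau> \<le> (\<Sum>i\<in>I. X i \<omega> * u i)} \<union> {\<omega>\<in>space M. \<tau> \<le> (\<Sum>i\<in>I. X i \<omega> * - u i)})"
    by (intro finite_measure_mono) (auto simp: sum_negf)
  also have "\<dots> \<le> prob {\<omega>\<in>space M. \<tau> \<le> (\<Sum>i\<in>I. X i \<omega> * u i)}
      + prob {\<omega>\<in>space M. \<tau> \<le> (\<Sum>i\<in>I. X i \<omega> * - u i)}"
    by (intro measure_Un_le) measurable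
  also have "\<dots> \<le> exp (- \<tau>\<^sup>2 / (4 * A * V)) + exp (- \<tau>\<^sup>2 / (4 * A * V))"
    using V by (intro add_mono sub_gaussian_sum_upper_tail[OF fin indep int mgf A _ _ \<tau>]) auto
  finally show ?thesis by simp
qed

subsection \<open>Chaining\<close>

lemma power_powr_swap:
  fixes a p :: real
  assumes "0 < a"
  shows "(a ^ m) powr p = (a powr p) ^ m"
  using assms by (induction m) (auto simp: powr_mult)

text \<open>The chain starts with the zero function at the scale of the norm of \<open>h\<close>; this yields the
  modulus of continuity directly, without peeling.\<close>

lemma empirical_inner_chaining:
  fixes C :: "nat \<Rightarrow> (real \<Rightarrow> real) set"
  assumes R: "0 < R" and p: "0 < p" and \<kappa>: "0 \<le> \<kappa>"
    and zero: "\<And>k. (\<lambda>_. 0) \<in> C k"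
    and cover: "\<And>k. \<exists>c\<in>C k. empirical_norm n x (\<lambda>t. h t - c t) \<le> R / 2 ^ k"
    and link: "\<And>k c c'. c \<in> C k \<Longrightarrow> c' \<in> C (Suc k) \<Longrightarrow>
      empirical_norm n x (\<lambda>t. c' t - c t) \<le> 3 * (R / 2 ^ Suc k) \<Longrightarrow>
      \<bar>empirical_inner n x v (\<lambda>t. c' t - c t)\<bar> \<le> \<kappa> * (R / 2 ^ Suc k) powr p"
    and h: "empirical_norm n x h \<le> R"
  shows "\<bar>empirical_inner n x v h\<bar> \<le> \<kappa> / (1 - 2 powr - p) * empirical_norm n x h powr p"
proof (cases "empirical_norm n x h = 0")
  \<comment> \<open>Here \<open>0 powr p\<close> is 0, and Cauchy-Schwarz makes the inner product
    vanish.\<close>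
  case True
  then show ?thesis
    using empirical_inner_le[of n x v h] by simp
next
  case False
  let ?N = "empirical_norm n x" and ?I = "empirical_inner n x v"
  have pos: "0 < ?N h"
    using False empirical_norm_nonneg[of n x h] by simp
  obtain k0 where "(1 / 2) ^ k0 < ?N h / R"
    using real_arch_pow_inv[of "?N h / R" "1 / 2"] pos R by auto
  then have k0: "R / 2 ^ k0 < ?N h"
    using R by (simp add: field_simps power_divide)
  \<comment> \<open>The first level whose radius is below the norm of \<open>h\<close>. The radius
    at level 0 is \<open>R\<close>, so there is a preceding level \<open>j\<close>, and its radius
    still dominates the norm.\<close>
  define k where "k = (LEAST k. R / 2 ^ k < ?N h)"
  have k: "R / 2 ^ k < ?N h"
    unfolding k_def by (rule LeastI[of _ k0]) fact
  with h have "k \<noteq> 0"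
    by (intro notI) simp
  then obtain j where j: "k = Suc j"
    by (cases k) auto
  have hj: "?N h \<le> R / 2 ^ j"
    using not_less_Least[of j "\<lambda>k. R / 2 ^ k < ?N h"] j k_def by simp
  obtain \<pi>0 where \<pi>0: "\<And>k. \<pi>0 k \<in> C k" "\<And>k. ?N (\<lambda>t. h t - \<pi>0 k t) \<le> R / 2 ^ k"
    using cover by metis
  \<comment> \<open>At level \<open>j\<close> the zero function is already close enough to
    \<open>h\<close>; starting there makes the telescoping sum have no initial term.\<close>
  define \<pi> where "\<pi> m = (if m = 0 then (\<lambda>_. 0) else \<pi>0 (j + m))" for m
  have \<pi>: "\<pi> m \<in> C (j + m)" "?N (\<lambda>t. h t - \<pi> m t) \<le> R / 2 ^ (j + m)" for m
    using \<pi>0 zero hj by (auto simp: \<pi>_def)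
  define \<rho> :: real where "\<rho> = 2 powr - p"
  have \<rho>: "0 < \<rho>" "\<rho> < 1"
    using p by (auto simp: \<rho>_def powr_minus field_simps)
  \<comment> \<open>The bound for the first link. Its radius is below the norm of \<open>h\<close>,
    which turns the sum of the geometric series into a multiple of
    \<open>?N h powr p\<close>.\<close>
  define B where "B = \<kappa> * (R / 2 ^ Suc j) powr p"
  have B: "0 \<le> B" "B \<le> \<kappa> * ?N h powr p"
    using \<kappa> k R p unfolding B_def j by (auto intro!: mult_left_mono powr_mono2)
  have step: "\<bar>?I (\<lambda>t. \<pi> (Suc m) t - \<pi> m t)\<bar> \<le> B * \<rho> ^ m" for m
  proof -
    have "?N (\<lambda>t. \<pi> (Suc m) t - \<pi> m t) \<le> R / 2 ^ (j + Suc m) + R / 2 ^ (j + m)"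
      using empirical_norm_diff_le[of n x "\<pi> (Suc m)" "\<pi> m" h] \<pi>(2)[of m] \<pi>(2)[of "Suc m"]
      by linarith
    \<comment> \<open>One finer radius plus one coarser radius, which is twice the finer
      one.\<close>
    then have "?N (\<lambda>t. \<pi> (Suc m) t - \<pi> m t) \<le> 3 * (R / 2 ^ Suc (j + m))"
      by (simp add: field_simps)
    then have "\<bar>?I (\<lambda>t. \<pi> (Suc m) t - \<pi> m t)\<bar> \<le> \<kappa> * (R / 2 ^ Suc (j + m)) powr p"
      using \<pi>(1)[of m] \<pi>(1)[of "Suc m"] by (intro link) auto
    also have "R / 2 ^ Suc (j + m) = R / 2 ^ Suc j * (1 / 2) ^ m"
      by (simp add: power_add power_divide)
    also have "\<dots> powr p = (R / 2 ^ Suc j) powr p * \<rho> ^ m"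
      using R by (simp add: \<rho>_def powr_mult power_powr_swap powr_minus powr_divide inverse_eq_divide)
    finally show ?thesis
      by (simp add: B_def mult_ac)
  qed
  \<comment> \<open>The chain of length \<open>J\<close> is bounded independently of
    \<open>J\<close>; the remainder goes to 0 as \<open>J\<close> grows.\<close>
  have "\<bar>?I h\<bar> \<le> B / (1 - \<rho>) + L2_set v {1..n} / sqrt (real n) * (R / 2 ^ j * (1 / 2) ^ J)" for J
  proof -
    have "?I (\<pi> J) = (\<Sum>m<J. ?I (\<lambda>t. \<pi> (Suc m) t - \<pi> m t))"
      using sum_lessThan_telescope[of "\<lambda>m. ?I (\<pi> m)" J]
      by (simp add: empirical_inner_diff) (simp add: \<pi>_def empirical_inner_def)
    then have "\<bar>?I (\<pi> J)\<bar> \<le> (\<Sum>m<J. B * \<rho> ^ m)"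
      using step by (auto intro!: order_trans[OF sum_abs] sum_mono)
    also have "\<dots> \<le> (\<Sum>m. B * \<rho> ^ m)"
      using B \<rho> by (intro sum_le_suminf summable_mult summable_geometric) auto
    also have "\<dots> = B / (1 - \<rho>)"
      using \<rho> by (simp add: suminf_mult summable_geometric suminf_geometric)
    finally have 1: "\<bar>?I (\<pi> J)\<bar> \<le> B / (1 - \<rho>)" .
    have "\<bar>?I (\<lambda>t. h t - \<pi> J t)\<bar>
        \<le> L2_set v {1..n} / sqrt (real n) * ?N (\<lambda>t. h t - \<pi> J t)"
      by (rule empirical_inner_le)
    also have "\<dots> \<le> L2_set v {1..n} / sqrt (real n) * (R / 2 ^ (j + J))"
      by (intro mult_left_mono \<pi>) auto
    also have "R / 2 ^ (j + J) = R / 2 ^ j * (1 / 2) ^ J"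
      by (simp add: power_add power_divide)
    finally show ?thesis
      using 1 by (simp add: empirical_inner_diff)
  qed
  moreover have "(\<lambda>J. B / (1 - \<rho>) + L2_set v {1..n} / sqrt (real n) * (R / 2 ^ j * (1 / 2) ^ J))
      \<longlonglongrightarrow> B / (1 - \<rho>) + L2_set v {1..n} / sqrt (real n) * (R / 2 ^ j * 0)"
    by (intro tendsto_intros LIMSEQ_power_zero) auto
  ultimately have "\<bar>?I h\<bar> \<le> B / (1 - \<rho>)"
    by (intro LIMSEQ_le_const) auto
  also have "\<dots> \<le> \<kappa> * ?N h powr p / (1 - \<rho>)"
    using B \<rho> by (intro divide_right_mono) auto
  finally show ?thesis
    by (simp add: \<rho>_def)
qed

section \<open>Probability bounds over all links of the chain\<close>

lemma (in prob_space) sub_gaussian_empirical_inner_tail: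
  fixes X :: "nat \<Rightarrow> 'a \<Rightarrow> real"
  assumes n: "1 \<le> n" and indep: "indep_vars (\<lambda>_. borel) X {1..n}"
    and int: "\<And>i s. i \<in> {1..n} \<Longrightarrow> integrable M (\<lambda>\<omega>. exp (s * X i \<omega>))"
    and mgf: "\<And>i s. i \<in> {1..n} \<Longrightarrow> expectation (\<lambda>\<omega>. exp (s * X i \<omega>)) \<le> exp (s\<^sup>2 * A)"
    and A: "0 < A" and b: "0 < b" "empirical_norm n x g \<le> b" and \<epsilon>: "0 < \<epsilon>"
  shows "prob {\<omega>\<in>space M. \<epsilon> \<le> \<bar>empirical_inner n x (\<lambda>i. X i \<omega>) g\<bar>}
    \<le> 2 * exp (- (real n * \<epsilon>\<^sup>2) / (4 * A * b\<^sup>2))"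
proof -
  have n0: "0 < real n"
    using n by simp
  have "(empirical_norm n x g)\<^sup>2 \<le> b\<^sup>2"
    using b by (intro power_mono empirical_norm_nonneg) auto
  then have V: "(\<Sum>i=1..n. (g (x i))\<^sup>2) \<le> real n * b\<^sup>2"
    using n0 by (simp add: empirical_norm_power2 field_simps)
  have "{\<omega>\<in>space M. \<epsilon> \<le> \<bar>empirical_inner n x (\<lambda>i. X i \<omega>) g\<bar>}
      = {\<omega>\<in>space M. real n * \<epsilon> \<le> \<bar>\<Sum>i=1..n. X i \<omega> * g (x i)\<bar>}"
    using n0 by (simp add: empirical_inner_def field_simps)
  also have "prob \<dots> \<le> 2 * exp (- (real n * \<epsilon>)\<^sup>2 / (4 * A * (real n * b\<^sup>2)))"
    using n0 \<epsilon> b V by (intro sub_gaussian_sum_tail[OF _ indep int mgf A]) auto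
  also have "(real n * \<epsilon>)\<^sup>2 / (4 * A * (real n * b\<^sup>2)) = real n * \<epsilon>\<^sup>2 / (4 * A * b\<^sup>2)"
    using n0 A b by (simp add: field_simps power2_eq_square)
  then have "- (real n * \<epsilon>)\<^sup>2 / (4 * A * (real n * b\<^sup>2)) = - (real n * \<epsilon>\<^sup>2) / (4 * A * b\<^sup>2)"
    by simp
  finally show ?thesis .
qed

text \<open>A union bound over the links at all levels gives one event for all \<open>h\<close> and
  all scales. With exponent \<open>1 - \<alpha> / 2\<close>, a link of radius \<open>r\<close> fails
  with probability at most \<open>2 * exp (- T\<^sup>2 * r powr - \<alpha> / (4 * A))\<close>; the
  logarithm of the number of links grows at the same rate \<open>r powr - \<alpha>\<close>, so a
  large \<open>T\<close> wins, uniformly in \<open>n\<close>.\<close>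

lemma (in prob_space) empirical_process_modulus:
  fixes X :: "nat \<Rightarrow> 'a \<Rightarrow> real"
  assumes n: "1 \<le> n" and indep: "indep_vars (\<lambda>_. borel) X {1..n}"
    and int: "\<And>i s. i \<in> {1..n} \<Longrightarrow> integrable M (\<lambda>\<omega>. exp (s * X i \<omega>))"
    and mgf: "\<And>i s. i \<in> {1..n} \<Longrightarrow> expectation (\<lambda>\<omega>. exp (s * X i \<omega>)) \<le> exp (s\<^sup>2 * A)"
    and A: "0 < A" and \<alpha>: "0 < \<alpha>" "\<alpha> < 2" and c: "0 < c" and R: "0 < R" and \<eta>: "0 < \<eta>"
    and entropy: "\<And>\<delta>. 0 < \<delta> \<Longrightarrow> Defs.entropy n x \<delta> G \<le> ereal (c * \<delta> powr - \<alpha>)"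
    and bounded: "\<And>h. h \<in> G \<Longrightarrow> empirical_norm n x h \<le> R"
    and T: "0 < T" "4 * A * (8 * R powr \<alpha> / (\<eta> * (1 - 2 powr - \<alpha>)) + 2 * c) \<le> T\<^sup>2"
  shows "\<exists>E\<in>sets M. prob E \<le> \<eta> \<and>
    (\<forall>\<omega>\<in>space M - E. \<forall>h\<in>G. \<bar>empirical_inner n x (\<lambda>i. X i \<omega>) h\<bar>
      \<le> 3 * T / sqrt (real n) / (1 - 2 powr - (1 - \<alpha> / 2)) * empirical_norm n x h powr (1 - \<alpha> / 2))"
proof -
  let ?N = "empirical_norm n x"
  let ?I = "\<lambda>\<omega>. empirical_inner n x (\<lambda>i. X i \<omega>)"
  define p where "p = 1 - \<alpha> / 2"
  define r where "r k = R / 2 ^ k" for k :: nat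
  define q :: real where "q = 2 powr - \<alpha>"
  \<comment> \<open>What the exponent retains after paying \<open>2 * c\<close> for the two covers
    of a link. The 8 collects a factor 2 from each cover and from the two-sided tail; the rest makes
    the failure probabilities sum to at most \<open>\<eta>\<close>.\<close>
  define \<gamma> where "\<gamma> = 8 * R powr \<alpha> / (\<eta> * (1 - q))"
  \<comment> \<open>The 3 cancels against the link length \<open>3 * r (Suc k)\<close> in the tail
    exponent.\<close>
  define \<kappa> where "\<kappa> = 3 * T / sqrt (real n)"
  have [measurable]: "i \<in> {1..n} \<Longrightarrow> X i \<in> borel_measurable M" for i
    using indep by (auto simp: indep_vars_def)
  have p: "0 < p"
    using \<alpha> by (simp add: p_def)
  have q: "0 < q" "q < 1"
    using \<alpha> by (auto simp: q_def powr_minus field_simps)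
  have r: "0 < r k" for k
    using R by (simp add: r_def)
  have \<gamma>: "0 < \<gamma>"
    using R \<eta> q by (simp add: \<gamma>_def)
  have \<kappa>: "0 < \<kappa>" and n\<kappa>: "real n * \<kappa>\<^sup>2 = 9 * T\<^sup>2"
    using n T by (auto simp: \<kappa>_def power_divide power_mult_distrib)
  have "\<forall>k. \<exists>C. finite C \<and> real (card C) \<le> exp (c * r k powr - \<alpha>) \<and>
      (\<forall>h\<in>G. \<exists>g\<in>C. ?N (\<lambda>t. h t - g t) \<le> r k)"
    using finite_cover_of_entropy_le[OF entropy[OF r]] by metis
  then obtain C0 where C0: "\<And>k. finite (C0 k)"
      "\<And>k. real (card (C0 k)) \<le> exp (c * r k powr - \<alpha>)"
      "\<And>k h. h \<in> G \<Longrightarrow> \<exists>g\<in>C0 k. ?N (\<lambda>t. h t - g t) \<le> r k"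
    by metis
  \<comment> \<open>Chaining may start at any level, so each cover must contain the zero function;
    this at most doubles the cardinality bound.\<close>
  define C where "C k = insert (\<lambda>_. 0) (C0 k)" for k
  have finC: "finite (C k)" for k
    using C0 by (simp add: C_def)
  have cardC: "real (card (C k)) \<le> 2 * exp (c * r k powr - \<alpha>)" for k
  proof -
    have "real (card (C k)) \<le> 1 + real (card (C0 k))"
      using card_insert_le_m1[of "Suc (card (C0 k))" "C0 k"] by (simp add: C_def C0 card_insert_if)
    also have "\<dots> \<le> exp (c * r k powr - \<alpha>) + exp (c * r k powr - \<alpha>)"
      using C0(2)[of k] c by (intro add_mono) auto
    finally show ?thesis by simp
  qed
  have cardC': "real (card (C k)) \<le> 2 * exp (c * r (Suc k) powr - \<alpha>)" for k
  proof -
    have "r (Suc k) \<le> r k"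
      using R by (simp add: r_def field_simps)
    then have "r k powr - \<alpha> \<le> r (Suc k) powr - \<alpha>"
      using \<alpha> r by (intro powr_mono2') auto
    with cardC[of k] c show ?thesis
      by (elim order_trans) auto
  qed
  \<comment> \<open>The covers do not depend on the noise, so each level has finitely many links,
    each with a measurable failure event.\<close>
  define B where "B k = {e \<in> C k \<times> C (Suc k). ?N (\<lambda>t. snd e t - fst e t) \<le> 3 * r (Suc k)}" for k
  define bad where
    "bad k e = {\<omega>\<in>space M. \<kappa> * r (Suc k) powr p \<le> \<bar>?I \<omega> (\<lambda>t. snd e t - fst e t)\<bar>}"
    for k and e :: "(real \<Rightarrow> real) \<times> (real \<Rightarrow> real)"
  define E where "E k = (\<Union>e\<in>B k. bad k e)" for k
  have finB: "finite (B k)" for k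
    using finC by (simp add: B_def)
  have bad_sets: "bad k e \<in> sets M" for k e
    unfolding bad_def empirical_inner_def by measurable
  have E_sets: "E k \<in> sets M" for k
    using finB bad_sets by (auto simp: E_def)
  have prob_bad: "prob (bad k e) \<le> 2 * exp (- (T\<^sup>2 * r (Suc k) powr - \<alpha>) / (4 * A))"
    if "e \<in> B k" for k e
  proof -
    have "prob (bad k e)
        \<le> 2 * exp (- (real n * (\<kappa> * r (Suc k) powr p)\<^sup>2) / (4 * A * (3 * r (Suc k))\<^sup>2))"
      unfolding bad_def
      using that r[of "Suc k"] \<kappa> by (intro sub_gaussian_empirical_inner_tail[OF n indep int mgf A]) (auto simp: B_def)
    also have "real n * (\<kappa> * r (Suc k) powr p)\<^sup>2 = 9 * T\<^sup>2 * ((r (Suc k))\<^sup>2 * r (Suc k) powr - \<alpha>)"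
    proof -
      have "(r (Suc k) powr p)\<^sup>2 = r (Suc k) powr (2 + - \<alpha>)"
        using r[of "Suc k"] by (simp add: power2_eq_square p_def flip: powr_add)
      also have "\<dots> = (r (Suc k))\<^sup>2 * r (Suc k) powr - \<alpha>"
        using r[of "Suc k"] by (simp only: powr_add) simp
      finally show ?thesis
        using n\<kappa> by (simp add: power_mult_distrib flip: mult.assoc)
    qed
    also have "- (9 * T\<^sup>2 * ((r (Suc k))\<^sup>2 * r (Suc k) powr - \<alpha>)) / (4 * A * (3 * r (Suc k))\<^sup>2)
        = - (T\<^sup>2 * r (Suc k) powr - \<alpha>) / (4 * A)"
      using r[of "Suc k"] A by (simp add: power_mult_distrib)
    finally show ?thesis .
  qed
  have prob_E: "prob (E k) \<le> \<eta> * (1 - q) * q ^ k" for k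
  proof -
    define z where "z = r (Suc k) powr - \<alpha>"
    have z: "0 < z"
      using r[of "Suc k"] by (simp add: z_def)
    have "prob (E k) \<le> (\<Sum>e\<in>B k. prob (bad k e))"
      unfolding E_def by (intro measure_UNION_le finB bad_sets)
    also have "\<dots> \<le> real (card (B k)) * (2 * exp (- (T\<^sup>2 * z) / (4 * A)))"
      using prob_bad unfolding z_def by (intro sum_bounded_above) auto
    also have "real (card (B k)) \<le> real (card (C k)) * real (card (C (Suc k)))"
      unfolding of_nat_mult[symmetric] card_cartesian_product[symmetric] of_nat_le_iff
      by (intro card_mono finite_cartesian_product finC) (auto simp: B_def)
    also have "\<dots> \<le> (2 * exp (c * z)) * (2 * exp (c * z))"
      unfolding z_def by (intro mult_mono cardC cardC') auto
    also have "(2 * exp (c * z)) * (2 * exp (c * z)) * (2 * exp (- (T\<^sup>2 * z) / (4 * A)))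
        = 8 * exp (- ((T\<^sup>2 / (4 * A) - 2 * c) * z))"
      by (simp add: algebra_simps flip: exp_add)
    also have "\<dots> \<le> 8 * exp (- (\<gamma> * z))"
    proof -
      have "\<gamma> + 2 * c \<le> T\<^sup>2 / (4 * A)"
        using T(2) A by (simp add: \<gamma>_def q_def field_simps)
      then show ?thesis
        using z by (simp add: mult_right_mono)
    qed
    \<comment> \<open>This crude bound is enough: \<open>1 / z\<close> is
      \<open>r (Suc k) powr \<alpha>\<close>, which is geometric in \<open>k\<close>.\<close>
    also have "\<dots> \<le> 8 * (1 / (\<gamma> * z))"
    proof -
      have "\<gamma> * z \<le> exp (\<gamma> * z)"
        using exp_ge_add_one_self[of "\<gamma> * z"] by linarith
      then show ?thesis
        using \<gamma> z by (simp add: exp_minus field_simps)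
    qed
    also have "\<dots> = 8 / \<gamma> * r (Suc k) powr \<alpha>"
      using r[of "Suc k"] by (simp add: z_def powr_minus field_simps)
    also have "r (Suc k) = R * (1 / 2) ^ Suc k"
      by (simp add: r_def power_divide)
    also have "\<dots> powr \<alpha> = R powr \<alpha> * q ^ Suc k"
      using R by (simp add: power_powr_swap powr_mult q_def powr_minus powr_divide inverse_eq_divide del: power_Suc)
    also have "8 / \<gamma> * (R powr \<alpha> * q ^ Suc k) = \<eta> * (1 - q) * q ^ k * q"
      using R \<eta> q by (simp add: \<gamma>_def field_simps)
    also have "\<dots> \<le> \<eta> * (1 - q) * q ^ k"
      using \<eta> q by (intro mult_left_le) auto
    finally show ?thesis
      by (simp add: mult_right_mono)
  qed
  have sums: "(\<lambda>k. \<eta> * (1 - q) * q ^ k) sums (\<eta> * (1 - q) * (1 / (1 - q)))"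
    using q by (intro sums_mult geometric_sums) auto
  have summable: "summable (\<lambda>k. prob (E k))"
    using prob_E by (intro summable_comparison_test[OF _ sums_summable[OF sums]]) auto
  have "prob (\<Union>k. E k) \<le> (\<Sum>k. prob (E k))"
    using E_sets summable by (intro finite_measure_subadditive_countably) auto
  also have "\<dots> \<le> (\<Sum>k. \<eta> * (1 - q) * q ^ k)"
    by (intro suminf_le prob_E summable sums_summable[OF sums])
  also have "\<dots> = \<eta>"
    using sums_unique[OF sums] q by simp
  finally have "prob (\<Union>k. E k) \<le> \<eta>" .
  moreover have "\<bar>?I \<omega> h\<bar> \<le> \<kappa> / (1 - 2 powr - p) * ?N h powr p"
    if \<omega>: "\<omega> \<in> space M - (\<Union>k. E k)" and h: "h \<in> G" for \<omega> h
  proof (rule empirical_inner_chaining[OF R p, where C = C])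
    show "\<exists>c\<in>C k. ?N (\<lambda>t. h t - c t) \<le> R / 2 ^ k" for k
      using C0(3)[OF h, of k] by (auto simp: C_def r_def)
    show "\<bar>?I \<omega> (\<lambda>t. c' t - c t)\<bar> \<le> \<kappa> * (R / 2 ^ Suc k) powr p"
      if "c \<in> C k" "c' \<in> C (Suc k)" "?N (\<lambda>t. c' t - c t) \<le> 3 * (R / 2 ^ Suc k)" for k c c'
    proof -
      have "(c, c') \<in> B k"
        using that by (simp add: B_def r_def)
      then have "\<omega> \<notin> bad k (c, c')"
        using \<omega> by (auto simp: E_def)
      then show ?thesis
        using \<omega> by (simp add: bad_def r_def)
    qed
  qed (use \<kappa> bounded h in \<open>auto simp: C_def\<close>)
  ultimately show ?thesis
    using E_sets by (intro bexI[of _ "\<Union>k. E k"]) (auto simp: p_def \<kappa>_def)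
qed

text \<open>At a radius where the entropy bound is 1/2, below \<open>ln 2\<close>, the cover has a
  single ball. It contains both \<open>h\<close> and 0, so the norm is at most its diameter. This
  supplies a radius \<open>R\<close> for the chaining that is independent of
  \<open>n\<close>.\<close>

lemma empirical_norm_le_of_entropy:
  assumes c: "0 < c" and \<alpha>: "0 < \<alpha>" and zero: "(\<lambda>_. 0) \<in> G" and h: "h \<in> G"
    and entropy: "\<And>\<delta>. 0 < \<delta> \<Longrightarrow> Defs.entropy n x \<delta> G \<le> ereal (c * \<delta> powr - \<alpha>)"
  shows "empirical_norm n x h \<le> 2 * (2 * c) powr (1 / \<alpha>)"
proof -
  define \<delta> where "\<delta> = (2 * c) powr (1 / \<alpha>)"
  have \<delta>: "0 < \<delta>"
    using c by (simp add: \<delta>_def)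
  have half: "c * \<delta> powr - \<alpha> = 1 / 2"
    using c \<alpha> by (simp add: \<delta>_def powr_powr powr_minus)
  obtain C where C: "finite C" "real (card C) \<le> exp (1 / 2)"
      "\<And>g. g \<in> G \<Longrightarrow> \<exists>c\<in>C. empirical_norm n x (\<lambda>t. g t - c t) \<le> \<delta>"
    using finite_cover_of_entropy_le[OF entropy[OF \<delta>]] unfolding half by metis
  have "exp (1 / 2 :: real) < 2"
    using exp_bound[of "1 / 2 :: real"] by (simp add: power2_eq_square)
  then have "card C \<le> Suc 0"
    using C(2) by linarith
  moreover obtain c0 where c0: "c0 \<in> C" "empirical_norm n x (\<lambda>t. 0 - c0 t) \<le> \<delta>"
    using C(3)[OF zero] by auto
  moreover obtain c1 where c1: "c1 \<in> C" "empirical_norm n x (\<lambda>t. h t - c1 t) \<le> \<delta>"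
    using C(3)[OF h] by auto
  ultimately have "c1 = c0"
    using C(1) by (meson card_le_Suc0_iff_eq)
  then have "empirical_norm n x (\<lambda>t. h t - 0) \<le> \<delta> + \<delta>"
    using empirical_norm_diff_le[of n x h "\<lambda>_. 0" c0] c0 c1 empirical_norm_scale[of n x "-1" c0]
      empirical_norm_minus_commute[of n x h c0]
    by simp
  then show ?thesis
    by (simp add: \<delta>_def)
qed

subsection \<open>The rate\<close>

text \<open>Young's inequality for \<open>sqrt (a * c)\<close> and \<open>b\<close>, with weights
  then bounded by 1. The coefficients are arranged so that \<open>b\<close> and half of
  \<open>a\<close> can be absorbed on the other side.\<close>

lemma powr_mult3_le:
  fixes a b c p q :: real
  assumes "0 < a" "0 < b" "0 < c" "0 \<le> p" "0 \<le> q" "2 * p + q = 1"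
  shows "a powr p * b powr q * c powr p \<le> (a + c) / 2 + b"
proof -
  have "a powr p * c powr p = sqrt (a * c) powr (2 * p)"
    using assms by (simp add: powr_mult powr_half_sqrt[symmetric] powr_powr)
  then have "a powr p * b powr q * c powr p = sqrt (a * c) powr (2 * p) * b powr q"
    by (simp add: mult_ac)
  also have "\<dots> \<le> 2 * p * sqrt (a * c) + q * b"
    using assms by (intro Youngs_inequality_0) auto
  also have "\<dots> \<le> sqrt (a * c) + b"
    using assms by (intro add_mono mult_left_le_one_le) auto
  also have "sqrt (a * c) \<le> (a + c) / 2"
    using assms by (intro arith_geo_mean_sqrt) auto
  finally show ?thesis by simp
qed

text \<open>The deterministic half of the argument, with \<open>S\<close> standing for the sum of
  the two penalties and \<open>p0\<close> for that of the truth. The modulus becomes a product of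
  powers of \<open>D\<^sup>2\<close>, \<open>lam * S\<close> and \<open>Z * lam\<close> whose
  exponents sum to 1.\<close>

lemma penalized_rate:
  fixes D S lam p0 \<Gamma> T C1 \<alpha> :: real
  assumes \<alpha>: "0 < \<alpha>" "\<alpha> < 2" and D: "0 \<le> D" and S: "0 < S" and p0: "0 \<le> p0"
    and \<Gamma>: "0 \<le> \<Gamma>" and T: "0 < T" and C1: "0 < C1" and n: "1 \<le> n"
    and lam: "real n powr (- 2 / (2 + \<alpha>)) \<le> C1 * lam"
    and basic: "D\<^sup>2 + lam * S
      \<le> 2 * (T / sqrt (real n) * D powr (1 - \<alpha> / 2) * S powr (\<alpha> / 2)) + 2 * lam * p0 + \<Gamma>"
  shows "D\<^sup>2 \<le> ((2 * T) powr (4 / (2 - \<alpha>)) * C1 powr ((2 + \<alpha>) / (2 - \<alpha>)) + 4 * p0 + 1) * (lam + 6 * \<Gamma>)"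
proof -
  \<comment> \<open>Chosen so that \<open>Z powr ((2 - \<alpha>) / 4)\<close> equals the whole
    constant in front of the product.\<close>
  define Z where "Z = (2 * T) powr (4 / (2 - \<alpha>)) * C1 powr ((2 + \<alpha>) / (2 - \<alpha>))"
  have n0: "0 < real n"
    using n by simp
  have "0 < C1 * lam"
    using lam n0 by (intro less_le_trans[OF _ lam]) simp
  then have lam0: "0 < lam"
    using C1 by (simp add: zero_less_mult_iff)
  have Z: "0 < Z"
    using T C1 by (simp add: Z_def)
  have "D\<^sup>2 \<le> Z * lam + 4 * p0 * lam + 2 * \<Gamma>"
  proof (cases "D = 0")
    case True
    then show ?thesis
      using Z lam0 p0 \<Gamma> by simp
  next
    case False
    with D have D0: "0 < D" by simp
    define p where "p = (2 - \<alpha>) / 4"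
    have p: "0 < p" "2 * p + \<alpha> / 2 = 1"
      using \<alpha> by (auto simp: p_def field_simps)
    have e: "4 * p / (2 - \<alpha>) = 1" "(2 + \<alpha>) * p / (2 - \<alpha>) = (2 + \<alpha>) / 4" "2 * p = 1 - \<alpha> / 2"
      using \<alpha> by (auto simp: p_def field_simps)
    have Zp: "Z powr p = 2 * T * C1 powr ((2 + \<alpha>) / 4)"
      using T C1 by (simp add: Z_def powr_mult powr_powr e)
    \<comment> \<open>Raising the lower bound on \<open>lam\<close> to the power
      \<open>(2 + \<alpha>) / 4\<close> produces the factor \<open>1 / sqrt (real n)\<close>. This
      power is \<open>\<alpha> / 2 + p\<close>: one part of \<open>lam\<close> joins
      \<open>S\<close>, the other joins \<open>Z\<close>.\<close>
    have "1 / sqrt (real n) = real n powr (- 1 / 2)"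
      using n0 by (simp add: powr_minus powr_half_sqrt inverse_eq_divide)
    also have "\<dots> = (real n powr (- 2 / (2 + \<alpha>))) powr ((2 + \<alpha>) / 4)"
    proof -
      have "- 2 / (2 + \<alpha>) * ((2 + \<alpha>) / 4) = - 1 / 2"
        using \<alpha> by (simp add: divide_simps)
      then show ?thesis
        by (simp only: powr_powr)
    qed
    also have "\<dots> \<le> (C1 * lam) powr ((2 + \<alpha>) / 4)"
      using \<alpha> lam by (intro powr_mono2) auto
    also have "\<dots> = C1 powr ((2 + \<alpha>) / 4) * lam powr ((2 + \<alpha>) / 4)"
      using C1 lam0 by (simp add: powr_mult)
    also have "lam powr ((2 + \<alpha>) / 4) = lam powr (\<alpha> / 2) * lam powr p"
      by (simp add: p_def field_simps flip: powr_add)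
    finally have sq: "1 / sqrt (real n) \<le> C1 powr ((2 + \<alpha>) / 4) * (lam powr (\<alpha> / 2) * lam powr p)" .
    have "2 * (T / sqrt (real n) * D powr (1 - \<alpha> / 2) * S powr (\<alpha> / 2))
        = 1 / sqrt (real n) * (2 * T * D powr (2 * p) * S powr (\<alpha> / 2))"
      by (simp only: e(3)) (simp add: mult_ac)
    also have "\<dots> \<le> C1 powr ((2 + \<alpha>) / 4) * (lam powr (\<alpha> / 2) * lam powr p)
        * (2 * T * D powr (2 * p) * S powr (\<alpha> / 2))"
      using T by (intro mult_right_mono sq) auto
    also have "D powr (2 * p) = (D\<^sup>2) powr p"
      using D0 by (simp add: powr_powr flip: powr_numeral)
    also have "C1 powr ((2 + \<alpha>) / 4) * (lam powr (\<alpha> / 2) * lam powr p)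
        * (2 * T * (D\<^sup>2) powr p * S powr (\<alpha> / 2))
      = (D\<^sup>2) powr p * (lam * S) powr (\<alpha> / 2) * (Z * lam) powr p"
      using lam0 S Z by (simp add: powr_mult Zp mult_ac)
    also have "\<dots> \<le> (D\<^sup>2 + Z * lam) / 2 + lam * S"
      using D0 lam0 S Z p \<alpha> by (intro powr_mult3_le) auto
    \<comment> \<open>The terms \<open>lam * S\<close> cancel, half of \<open>D\<^sup>2\<close>
      moves to the left, and doubling gives the coefficients 4 and 2.\<close>
    finally show ?thesis
      using basic by argo
  qed
  also have "\<dots> \<le> (Z + 4 * p0 + 1) * (lam + 6 * \<Gamma>)"
  proof -
    \<comment> \<open>The summand 1 makes the factor at least 1, so that \<open>2 * \<Gamma>\<close>
      is covered.\<close>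
    have "(Z + 4 * p0 + 1) * (lam + 6 * \<Gamma>)
        = Z * lam + 4 * p0 * lam + 2 * \<Gamma> + (lam + 4 * \<Gamma> + 6 * (Z * \<Gamma>) + 24 * (p0 * \<Gamma>))"
      by (simp add: algebra_simps)
    moreover have "0 \<le> Z * \<Gamma>" "0 \<le> p0 * \<Gamma>"
      using Z p0 \<Gamma> by auto
    ultimately show ?thesis
      using lam0 \<Gamma> by linarith
  qed
  finally show ?thesis
    by (simp add: Z_def)
qed

section \<open>Stochastic boundedness through exceptional events, and the theorem\<close>

lemma sobolev_penalty_nonneg: "0 \<le> sobolev_penalty r l a b f"
  unfolding sobolev_penalty_def set_lebesgue_integral_def by (intro integral_nonneg_AE) auto

text \<open>Measurable exceptional events can be joined by subadditivity, so the probabilistic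
  argument is carried out with them instead of outer measures.\<close>

lemma bounded_in_probI:
  assumes "\<And>\<eta>. 0 < \<eta> \<Longrightarrow> \<exists>C::real. \<forall>\<^sub>F n in sequentially. \<exists>E\<in>sets M.
    emeasure M E \<le> ennreal \<eta> \<and> (\<forall>\<omega>\<in>space M - E. \<bar>Z n \<omega>\<bar> \<le> C * A n \<omega>)"
  shows "bounded_in_prob M Z A"
  unfolding bounded_in_prob_def
proof (intro allI impI)
  fix \<eta> :: real assume "0 < \<eta>"
  from assms[OF this] obtain C where C: "\<forall>\<^sub>F n in sequentially. \<exists>E\<in>sets M.
    emeasure M E \<le> ennreal \<eta> \<and> (\<forall>\<omega>\<in>space M - E. \<bar>Z n \<omega>\<bar> \<le> C * A n \<omega>)" ..
  have "\<forall>\<^sub>F n in sequentially.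
      outer_measure_of M {\<omega> \<in> space M. \<bar>Z n \<omega>\<bar> > C * A n \<omega>} \<le> ennreal \<eta>"
    using C
  proof eventually_elim
    case (elim n)
    then obtain E where E: "E \<in> sets M" "emeasure M E \<le> ennreal \<eta>"
        "\<forall>\<omega>\<in>space M - E. \<bar>Z n \<omega>\<bar> \<le> C * A n \<omega>" by blast
    then have "{\<omega> \<in> space M. \<bar>Z n \<omega>\<bar> > C * A n \<omega>} \<subseteq> E" by force
    from outer_measure_of_mono[OF this, of M] E show ?case
      by simp
  qed
  then show "\<exists>C. limsup (\<lambda>n. outer_measure_of M {\<omega> \<in> space M. \<bar>Z n \<omega>\<bar> > C * A n \<omega>}) \<le> ennreal \<eta>"
    by (intro exI[of _ C] Limsup_bounded)
qed

text \<open>A measurable hull of the exceptional set has measure equal to its outer measure.\<close>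

lemma bounded_in_probD:
  assumes "bounded_in_prob M Z A" "0 < \<eta>"
  obtains C where "\<forall>\<^sub>F n in sequentially. \<exists>E\<in>sets M.
    emeasure M E \<le> ennreal \<eta> \<and> (\<forall>\<omega>\<in>space M - E. \<bar>Z n \<omega>\<bar> \<le> C * A n \<omega>)"
proof -
  \<comment> \<open>Halving \<open>\<eta>\<close> gives the strict inequality needed to pass from a
    limsup to eventually all \<open>n\<close>.\<close>
  obtain C where "limsup (\<lambda>n. outer_measure_of M {\<omega> \<in> space M. \<bar>Z n \<omega>\<bar> > C * A n \<omega>}) \<le> ennreal (\<eta> / 2)"
    using assms unfolding bounded_in_prob_def by (meson half_gt_zero)
  also have "ennreal (\<eta> / 2) < ennreal \<eta>"
    using assms by (simp add: ennreal_lessI)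
  finally have "\<forall>\<^sub>F n in sequentially.
      outer_measure_of M {\<omega> \<in> space M. \<bar>Z n \<omega>\<bar> > C * A n \<omega>} < ennreal \<eta>"
    by (rule Limsup_lessD)
  then have "\<forall>\<^sub>F n in sequentially. \<exists>E\<in>sets M.
      emeasure M E \<le> ennreal \<eta> \<and> (\<forall>\<omega>\<in>space M - E. \<bar>Z n \<omega>\<bar> \<le> C * A n \<omega>)"
  proof eventually_elim
    case (elim n)
    obtain E where "E \<in> sets M" "{\<omega> \<in> space M. \<bar>Z n \<omega>\<bar> > C * A n \<omega>} \<subseteq> E"
        "outer_measure_of M {\<omega> \<in> space M. \<bar>Z n \<omega>\<bar> > C * A n \<omega>} = emeasure M E"
      using outer_measure_of_attain[of "{\<omega> \<in> space M. \<bar>Z n \<omega>\<bar> > C * A n \<omega>}" M] by auto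
    with elim show ?case
      by (intro bexI[of _ E]) (auto simp: not_less[symmetric])
  qed
  then show thesis by (rule that)
qed

theorem theorem7p2:
  fixes M :: "'a measure"
    and a b l \<alpha> c\<^sub>1 c\<^sub>2 K \<sigma>\<^sub>0 :: real and r :: nat
    and F :: "(real \<Rightarrow> real) set" and f_star :: "real \<Rightarrow> real"
    and P :: "(real \<Rightarrow> real) \<Rightarrow> real"
    and x :: "nat \<Rightarrow> nat \<Rightarrow> real"
    and w y :: "nat \<Rightarrow> nat \<Rightarrow> 'a \<Rightarrow> real"
    and m :: "nat \<Rightarrow> nat" and d :: "nat \<Rightarrow> nat \<Rightarrow> real"
    and \<Omega> :: "nat \<Rightarrow> (nat \<Rightarrow> real) \<Rightarrow> real \<Rightarrow> real"
    and lam :: "nat \<Rightarrow> 'a \<Rightarrow> real" and \<Gamma> :: "nat \<Rightarrow> nat \<Rightarrow> 'a \<Rightarrow> real"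
    and f_hat :: "nat \<Rightarrow> 'a \<Rightarrow> real \<Rightarrow> real" and f_tilde :: "nat \<Rightarrow> 'a \<Rightarrow> nat \<Rightarrow> real"
  assumes "prob_space M"
    and "a < b" and "l > 0"
    and P_def: "P = sobolev_penalty r l a b"
    and P_finite: "\<forall>f\<in>F. sobolev_finite r l a b f"
    and "function_cone F" and "f_star \<in> F" and "P f_star > 0"
    and design: "\<forall>n\<ge>1. \<forall>i\<in>{1..n}. x n i \<in> {a..b}"
    and observations:
      "\<forall>n\<ge>1. \<forall>i\<in>{1..n}. \<forall>\<omega>\<in>space M. y n i \<omega> = f_star (x n i) + w n i \<omega>"
    and errors_indep:
      "\<forall>n\<ge>1. prob_space.indep_vars M (\<lambda>_. borel) (\<lambda>i. w n i) {1..n}"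
    and errors_identical:
      "\<forall>n\<ge>1. \<forall>i\<in>{1..n}. distr M borel (w n i) = distr M borel (w n 1)"
    and errors_moments:
      "\<forall>n\<ge>1. \<forall>i\<in>{1..n}. integrable M (\<lambda>\<omega>. (w n i \<omega>)\<^sup>2)
         \<and> prob_space.expectation M (w n i) = 0"
    and "K > 0" and "\<sigma>\<^sub>0 > 0"
    and sub_gaussian:
      "\<forall>n\<ge>1. \<forall>i\<in>{1..n}. integrable M (\<lambda>\<omega>. exp (\<bar>w n i \<omega>\<bar>\<^sup>2 / K\<^sup>2))
         \<and> K\<^sup>2 * (prob_space.expectation M (\<lambda>\<omega>. exp (\<bar>w n i \<omega>\<bar>\<^sup>2 / K\<^sup>2)) - 1) \<le> \<sigma>\<^sub>0\<^sup>2"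
    and "0 < \<alpha>" and "\<alpha> < 2" and "c\<^sub>1 > 0" and "c\<^sub>2 > 0"
    and entropy_ball:
      "\<forall>n\<ge>1. \<forall>\<delta>>0. entropy n (x n) \<delta> {f \<in> F. P f \<le> 1} \<le> ereal (c\<^sub>1 * \<delta> powr (- \<alpha>))"
    and entropy_ratio:
      "\<forall>n\<ge>1. \<forall>\<delta>>0.
         entropy n (x n) \<delta>
           {(\<lambda>t. (f t - f_star t) / (P f + P f_star)) | f. f \<in> F \<and> P f + P f_star > 0}
         \<le> ereal (c\<^sub>2 * \<delta> powr (- \<alpha>))"
    and mesh: "\<forall>n\<ge>1. is_mesh a b (m n) (d n)"
    and interpolator: "\<forall>n\<ge>1. linear_interpolator a b F (m n) (d n) (\<Omega> n)"
    and lam_nonneg: "\<forall>n\<ge>1. \<forall>\<omega>\<in>space M. lam n \<omega> \<ge> 0"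
    and lam_upper: "bounded_in_prob M lam (\<lambda>n \<omega>. real n powr (- 2 / (2 + \<alpha>)))"
    and lam_lower: "bounded_in_prob M (\<lambda>n \<omega>. real n powr (- 2 / (2 + \<alpha>))) lam"
    and f_hat:
      "\<forall>n\<ge>1. \<forall>\<omega>\<in>space M.
         is_arg_min (objective P n (x n) (\<lambda>i. y n i \<omega>) (lam n \<omega>)) (\<lambda>f. f \<in> F) (f_hat n \<omega>)"
    and f_tilde:
      "\<forall>n\<ge>1. \<forall>\<omega>\<in>space M.
         is_arg_min
           (mesh_objective (mesh_penalty r l (m n) (d n)) (\<Omega> n) n (x n) (\<lambda>i. y n i \<omega>) (lam n \<omega>))
           (\<lambda>v. v \<in> Rvec (m n)) (f_tilde n \<omega>)"
    and near_minimal: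
      "\<forall>n\<ge>1. AE \<omega> in M.
         objective P n (x n) (\<lambda>i. y n i \<omega>) (lam n \<omega>) (\<Omega> n (f_tilde n \<omega>))
         \<le> objective P n (x n) (\<lambda>i. y n i \<omega>) (lam n \<omega>) (f_hat n \<omega>) + \<Gamma> n (m n) \<omega>"
  shows "bounded_in_prob M
           (\<lambda>n \<omega>. (empirical_norm n (x n) (\<lambda>t. \<Omega> n (f_tilde n \<omega>) t - f_star t))\<^sup>2)
           (\<lambda>n \<omega>. lam n \<omega> + 6 * \<Gamma> n (m n) \<omega>)"
proof (rule bounded_in_probI)
  interpret prob_space M by fact
  fix \<eta> :: real assume \<eta>: "0 < \<eta>"
  define A where "A = K\<^sup>2 + \<sigma>\<^sub>0\<^sup>2"
  define R where "R = 2 * (2 * c\<^sub>2) powr (1 / \<alpha>)"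
  \<comment> \<open>The least value that \<open>empirical_process_modulus\<close> admits at level
    \<open>\<eta> / 2\<close>; the other half of \<open>\<eta>\<close> is spent on the lower bound
    for \<open>lam\<close>.\<close>
  define T0 where "T0 = sqrt (4 * A * (8 * R powr \<alpha> / (\<eta> / 2 * (1 - 2 powr - \<alpha>)) + 2 * c\<^sub>2))"
  define T where "T = 3 * T0 / (1 - 2 powr - (1 - \<alpha> / 2))"
  define p0 where "p0 = P f_star"
  define G where
    "G = {(\<lambda>t. (f t - f_star t) / (P f + P f_star)) | f. f \<in> F \<and> P f + P f_star > 0}"
  have A: "0 < A"
    using \<open>K > 0\<close> by (simp add: A_def add_pos_nonneg)
  have R: "0 < R"
    using \<open>c\<^sub>2 > 0\<close> by (simp add: R_def)
  have "2 powr - \<alpha> < 1" "2 powr - (1 - \<alpha> / 2) < 1"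
    using \<open>0 < \<alpha>\<close> \<open>\<alpha> < 2\<close> by (auto simp: powr_less_one)
  then have "0 < 4 * A * (8 * R powr \<alpha> / (\<eta> / 2 * (1 - 2 powr - \<alpha>)) + 2 * c\<^sub>2)"
    using A R \<eta> \<open>c\<^sub>2 > 0\<close> by (intro mult_pos_pos add_pos_pos divide_pos_pos) auto
  then have T0: "0 < T0"
    "T0\<^sup>2 = 4 * A * (8 * R powr \<alpha> / (\<eta> / 2 * (1 - 2 powr - \<alpha>)) + 2 * c\<^sub>2)"
    by (auto simp: T0_def)
  have T: "0 < T"
    using T0 \<open>2 powr - (1 - \<alpha> / 2) < 1\<close> by (simp add: T_def)
  have p0: "0 < p0"
    using \<open>P f_star > 0\<close> by (simp add: p0_def)
  have P_nonneg: "0 \<le> P f" for f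
    by (simp add: P_def sobolev_penalty_nonneg)
  obtain C0 where C0: "\<forall>\<^sub>F n in sequentially. \<exists>E\<in>sets M. emeasure M E \<le> ennreal (\<eta> / 2) \<and>
      (\<forall>\<omega>\<in>space M - E. \<bar>real n powr (- 2 / (2 + \<alpha>))\<bar> \<le> C0 * lam n \<omega>)"
    using bounded_in_probD[OF lam_lower, of "\<eta> / 2"] \<eta> by auto
  define C1 where "C1 = max 1 C0"
  have C1: "0 < C1" "C0 \<le> C1"
    by (auto simp: C1_def)
  define C where "C = (2 * T) powr (4 / (2 - \<alpha>)) * C1 powr ((2 + \<alpha>) / (2 - \<alpha>)) + 4 * p0 + 1"
  \<comment> \<open>The choice \<open>f = f_star\<close> is admissible because the penalty of
    \<open>f_star\<close> is positive.\<close>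
  have zero_G: "(\<lambda>_. 0) \<in> G"
    using \<open>f_star \<in> F\<close> \<open>P f_star > 0\<close> unfolding G_def by (auto intro!: exI[of _ f_star])
  show "\<exists>C. \<forall>\<^sub>F n in sequentially. \<exists>E\<in>sets M. emeasure M E \<le> ennreal \<eta> \<and>
      (\<forall>\<omega>\<in>space M - E.
        \<bar>(empirical_norm n (x n) (\<lambda>t. \<Omega> n (f_tilde n \<omega>) t - f_star t))\<^sup>2\<bar>
          \<le> C * (lam n \<omega> + 6 * \<Gamma> n (m n) \<omega>))"
  proof (rule exI[of _ C], use C0 eventually_ge_at_top[of 1] in eventually_elim)
    case (elim n)
    note n = \<open>1 \<le> n\<close>
    obtain E1 where E1: "E1 \<in> sets M" "emeasure M E1 \<le> ennreal (\<eta> / 2)"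
        "\<And>\<omega>. \<omega> \<in> space M - E1 \<Longrightarrow> real n powr (- 2 / (2 + \<alpha>)) \<le> C0 * lam n \<omega>"
      using elim by auto
    have entr: "0 < \<delta> \<Longrightarrow> Defs.entropy n (x n) \<delta> G \<le> ereal (c\<^sub>2 * \<delta> powr - \<alpha>)" for \<delta>
      using entropy_ratio n by (simp add: G_def)
    have indep: "indep_vars (\<lambda>_. borel) (w n) {1..n}"
      using errors_indep n by blast
    have int_w: "integrable M (w n i)" if "i \<in> {1..n}" for i
    proof (rule square_integrable_imp_integrable)
      show "w n i \<in> borel_measurable M"
        using indep that by (auto simp: indep_vars_def)
      show "integrable M (\<lambda>\<omega>. (w n i \<omega>)\<^sup>2)"
        using errors_moments n that by blast
    qed
    have mgf: "integrable M (\<lambda>\<omega>. exp (s * w n i \<omega>))"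
        "expectation (\<lambda>\<omega>. exp (s * w n i \<omega>)) \<le> exp (s\<^sup>2 * A)" if "i \<in> {1..n}" for i s
      unfolding A_def
      using sub_gaussian_mgf[OF int_w[OF that] _ \<open>K > 0\<close>, of \<sigma>\<^sub>0 s] errors_moments sub_gaussian n that
      by simp_all
    have "\<exists>E\<in>sets M. prob E \<le> \<eta> / 2 \<and>
      (\<forall>\<omega>\<in>space M - E. \<forall>h\<in>G. \<bar>empirical_inner n (x n) (\<lambda>i. w n i \<omega>) h\<bar>
        \<le> 3 * T0 / sqrt (real n) / (1 - 2 powr - (1 - \<alpha> / 2))
          * empirical_norm n (x n) h powr (1 - \<alpha> / 2))"
      using \<eta> empirical_norm_le_of_entropy[OF \<open>c\<^sub>2 > 0\<close> \<open>0 < \<alpha>\<close> zero_G _ entr]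
      by (intro empirical_process_modulus[OF n indep mgf A \<open>0 < \<alpha>\<close> \<open>\<alpha> < 2\<close> \<open>c\<^sub>2 > 0\<close> R _ entr _ T0(1)])
        (auto simp: R_def[symmetric] T0(2))
    then obtain E2 where E2: "E2 \<in> sets M" "prob E2 \<le> \<eta> / 2"
        "\<And>\<omega> h. \<omega> \<in> space M - E2 \<Longrightarrow> h \<in> G \<Longrightarrow> \<bar>empirical_inner n (x n) (\<lambda>i. w n i \<omega>) h\<bar>
          \<le> 3 * T0 / sqrt (real n) / (1 - 2 powr - (1 - \<alpha> / 2))
            * empirical_norm n (x n) h powr (1 - \<alpha> / 2)"
      by blast
    \<comment> \<open>Near-minimality holds only almost everywhere; its null set adds nothing to the
      measure of the exceptional event.\<close>
    obtain E3 where E3: "E3 \<in> null_sets M"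
        "\<And>\<omega>. \<omega> \<in> space M - E3 \<Longrightarrow>
         objective P n (x n) (\<lambda>i. y n i \<omega>) (lam n \<omega>) (\<Omega> n (f_tilde n \<omega>))
         \<le> objective P n (x n) (\<lambda>i. y n i \<omega>) (lam n \<omega>) (f_hat n \<omega>) + \<Gamma> n (m n) \<omega>"
      using near_minimal n unfolding eventually_ae_filter by blast
    show ?case
    proof (intro bexI[of _ "E1 \<union> E2 \<union> E3"] conjI ballI)
      show "E1 \<union> E2 \<union> E3 \<in> sets M"
        using E1 E2 E3 by auto
      have "emeasure M (E1 \<union> E2 \<union> E3) = emeasure M (E1 \<union> E2)"
        using E1 E2 E3 by (intro emeasure_Un_null_set) auto
      also have "\<dots> \<le> emeasure M E1 + emeasure M E2"
        using E1 E2 by (intro emeasure_subadditive) auto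
      also have "\<dots> \<le> ennreal (\<eta> / 2) + ennreal (\<eta> / 2)"
        using E1 E2 by (intro add_mono) (auto simp: emeasure_eq_measure ennreal_leI)
      also have "\<dots> = ennreal \<eta>"
        using \<eta> by (simp flip: ennreal_plus)
      finally show "emeasure M (E1 \<union> E2 \<union> E3) \<le> ennreal \<eta>" .
    next
      fix \<omega> assume \<omega>: "\<omega> \<in> space M - (E1 \<union> E2 \<union> E3)"
      define g where "g = \<Omega> n (f_tilde n \<omega>)"
      define S where "S = P g + p0"
      define D where "D = empirical_norm n (x n) (\<lambda>t. g t - f_star t)"
      define L where "L = objective P n (x n) (\<lambda>i. y n i \<omega>) (lam n \<omega>)"
      let ?inner = "empirical_inner n (x n) (\<lambda>i. w n i \<omega>)"
      have "f_tilde n \<omega> \<in> Rvec (m n)"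
        using f_tilde n \<omega> by (auto simp: is_arg_min_def)
      then have g: "g \<in> F"
        using interpolator n by (auto simp: linear_interpolator_def g_def)
      have min: "L (f_hat n \<omega>) \<le> L f" if "f \<in> F" for f
        using f_hat n \<omega> that by (auto simp: is_arg_min_def L_def not_less)
      have near: "L g \<le> L (f_hat n \<omega>) + \<Gamma> n (m n) \<omega>"
        using E3 \<omega> by (auto simp: L_def g_def)
      \<comment> \<open>The interpolant lies in \<open>F\<close>, so it cannot beat the minimizer
        \<open>f_hat\<close>.\<close>
      have \<Gamma>: "0 \<le> \<Gamma> n (m n) \<omega>"
        using near min[OF g] by linarith
      have L: "L f = (\<Sum>i=1..n. (w n i \<omega>)\<^sup>2) / real n - 2 * ?inner (\<lambda>t. f t - f_star t)
          + (empirical_norm n (x n) (\<lambda>t. f t - f_star t))\<^sup>2 + lam n \<omega> * P f" for f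
      proof -
        have "L f = objective P n (x n) (\<lambda>i. f_star (x n i) + w n i \<omega>) (lam n \<omega>) f"
          using observations n \<omega> by (simp add: L_def objective_def)
        then show ?thesis
          using objective_add_noise[of P n "x n" f_star "\<lambda>i. w n i \<omega>" "lam n \<omega>" f] by simp
      qed
      have S: "0 < S"
        using P_nonneg[of g] p0 by (simp add: S_def)
      have "L g \<le> L f_star + \<Gamma> n (m n) \<omega>"
        using near min[OF \<open>f_star \<in> F\<close>] by linarith
      \<comment> \<open>Adding \<open>lam n \<omega> * p0\<close> to both sides completes the
        penalty to \<open>S\<close>, the normalizer of the ratio class; hence the 2 in front of
        \<open>lam n \<omega> * p0\<close>.\<close>
      then have "D\<^sup>2 + lam n \<omega> * S \<le> 2 * ?inner (\<lambda>t. g t - f_star t) + 2 * lam n \<omega> * p0 + \<Gamma> n (m n) \<omega>"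
        by (simp add: L D_def S_def p0_def algebra_simps empirical_norm_def empirical_inner_def)
      also have "?inner (\<lambda>t. g t - f_star t) \<le> T / sqrt (real n) * D powr (1 - \<alpha> / 2) * S powr (\<alpha> / 2)"
      proof -
        define h where "h t = (g t - f_star t) / S" for t
        have h: "h \<in> G"
          using g S unfolding G_def h_def S_def p0_def by blast
        have gh: "(\<lambda>t. g t - f_star t) = (\<lambda>t. S * h t)"
          using S by (simp add: h_def)
        have D: "D = S * empirical_norm n (x n) h"
          using S unfolding D_def gh empirical_norm_scale by simp
        have "?inner (\<lambda>t. g t - f_star t) = S * ?inner h"
          unfolding gh empirical_inner_scale ..
        also have "\<dots> \<le> S * (T / sqrt (real n) * empirical_norm n (x n) h powr (1 - \<alpha> / 2))"
          using E2(3)[OF _ h, of \<omega>] \<omega> S by (intro mult_left_mono) (auto simp: T_def mult.commute)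
        \<comment> \<open>Splitting \<open>S\<close> this way lets one factor turn the norm of
          \<open>h\<close> back into \<open>D\<close>.\<close>
        also have "\<dots> = T / sqrt (real n) * (S powr (1 - \<alpha> / 2)
            * empirical_norm n (x n) h powr (1 - \<alpha> / 2)) * S powr (\<alpha> / 2)"
          using S by (simp add: powr_diff)
        also have "S powr (1 - \<alpha> / 2) * empirical_norm n (x n) h powr (1 - \<alpha> / 2) = D powr (1 - \<alpha> / 2)"
          using S unfolding D by (simp add: powr_mult empirical_norm_nonneg)
        finally show ?thesis .
      qed
      finally have basic: "D\<^sup>2 + lam n \<omega> * S \<le> 2 * (T / sqrt (real n) * D powr (1 - \<alpha> / 2) * S powr (\<alpha> / 2))
          + 2 * lam n \<omega> * p0 + \<Gamma> n (m n) \<omega>"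
        by simp
      have "real n powr (- 2 / (2 + \<alpha>)) \<le> C0 * lam n \<omega>"
        using E1 \<omega> by blast
      also have "\<dots> \<le> C1 * lam n \<omega>"
        using C1 lam_nonneg n \<omega> by (intro mult_right_mono) auto
      finally have lam: "real n powr (- 2 / (2 + \<alpha>)) \<le> C1 * lam n \<omega>" .
      have "D\<^sup>2 \<le> C * (lam n \<omega> + 6 * \<Gamma> n (m n) \<omega>)"
        unfolding C_def
        using penalized_rate[OF \<open>0 < \<alpha>\<close> \<open>\<alpha> < 2\<close> _ S _ \<Gamma> T C1(1) n lam basic] p0
        by (simp add: D_def empirical_norm_nonneg)
      then show "\<bar>(empirical_norm n (x n) (\<lambda>t. \<Omega> n (f_tilde n \<omega>) t - f_star t))\<^sup>2\<bar>
          \<le> C * (lam n \<omega> + 6 * \<Gamma> n (m n) \<omega>)"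
        by (simp add: D_def g_def)
    qed
  qed
qed

end
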